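(* Let $N\ge1$ and let $J$ be the junction with $N$ branches described in the context. Assume (A0) and (A1) of the context and let $T>0$. Let $u=(u^\alpha)_\alpha:[0,T)\times J\to\mathbb R$ be a viscosity solution of the Hamilton–Jacobi problem with initial data $u_0$ that is constructed from the scheme of the context, i.e. there is a sequence $\varepsilon_k=(\Delta t_k,\Delta x_k)\to(0,0)$ of pairs of positive numbers satisfying the CFL condition of the context such that the numerical solutions with initial condition $U^{\alpha,0}_i=u^\alpha_0(i\Delta x_k)$ converge to $u$ locally uniformly: for every compact $\mathcal K\subset[0,T)\times J$, $\sup_{(n\Delta t_k,i\Delta x_k)\in\mathcal K}|u^\alpha(n\Delta t_k,i\Delta x_k)-U^{\alpha,n}_i|\to0$ as $k\to\infty$ (supremum over grid points of all branches $\alpha$ lying in $\mathcal K$). Then for all $\alpha=1,\dots,N$, all $a\ge0$, all $x\ge0$ and all $t\in[0,T)$ (with moreover $t+a<T$ in the first line), $$a\,m^0_0\le u^\alpha(t+a,x)-u^\alpha(t,x)\le a\,M^0_0,$$ $$a\,\underline p^0_\alpha\le u^\alpha(t,x+a)-u^\alpha(t,x)\le a\,\overline p^0_\alpha,$$ where $$m^0_0=\inf_{\alpha=1,\dots,N,\ L^{\alpha,-}\le p\le L^{\alpha,+}}\bigl(-H_\alpha(p)\bigr),$$ $$M^0_0=\max\Bigl[\max_{\alpha}\bigl\{-\max\{H^-_\alpha(L^{\alpha,+}),H^+_\alpha(L^{\alpha,-})\}\bigr\},\ -\max_{\alpha}H^-_\alpha(L^{\alpha,+})\Bigr],$$ $$\underline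 p^0_\alpha=(H^-_\alpha)^{-1}(-m^0_0),\qquad \overline p^0_\alpha=(H^+_\alpha)^{-1}(-m^0_0),$$ and $L^{\alpha,-}$, $L^{\alpha,+}$ are the best constants such that $aL^{\alpha,-}\le u_0^\alpha(x+a)-u_0^\alpha(x)\le aL^{\alpha,+}$ for all $x\ge0$, $a\ge0$.
   Context: Junction: $e_1,\dots,e_N\in\mathbb R^2$ are distinct unit vectors, $J_\alpha=[0,+\infty)e_\alpha$, $J_\alpha^*=J_\alpha\setminus\{0\}$, $J=\bigcup_\alpha J_\alpha$, $J_T=(0,T)\times J$. For a function $u$ of $(t,y)$, $y\in J$, write $u^\alpha(t,x)=u(t,xe_\alpha)$, $x\ge 0$; the grid point $(n\Delta t,i\Delta x)$ of branch $\alpha$ is identified with $(n\Delta t,i\Delta x\,e_\alpha)$. $C^1_*(J_T)$ is the set of $u\in C(J_T)$ with $u^\alpha\in C^1((0,T)\times[0,+\infty))$ for every $\alpha$. (A0): $u_0=(u_0^\alpha)_\alpha$ is globally Lipschitz on $J$, i.e. each $u_0^\alpha$ is Lipschitz on $[0,+\infty)$ and $u_0^\alpha(0)=u_0^\beta(0)$ for all $\alpha,\beta$. (A1): for each $\alpha$, $H_\alpha\in C^1(\mathbb R;\mathbb R)$, $\lim_{|p|\to\infty}H_\alpha(p)=+\infty$, and there is $p_0^\alpha$ such that $H_\alpha$ is non-increasing on $(-\infty,p_0^\alpha]$ and non-decreasing on $[p_0^\alpha,+\infty)$; $p_0^\alpha$ is assumed unique (no plateau at the minimum). $H_\alpha^-=H_\alpha$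 on $(-\infty,p_0^\alpha]$ and $H_\alpha^-=H_\alpha(p_0^\alpha)$ on $[p_0^\alpha,+\infty)$; $H_\alpha^+=H_\alpha(p_0^\alpha)$ on $(-\infty,p_0^\alpha]$ and $H_\alpha^+=H_\alpha$ on $[p_0^\alpha,+\infty)$. Generalized inverses: $(H_\alpha^-)^{-1}(a)=\inf\{p:H_\alpha^-(p)=a\}$, $(H_\alpha^+)^{-1}(a)=\sup\{p:H_\alpha^+(p)=a\}$, $(H_\alpha^\pm)^{-1}(+\infty)=\pm\infty$. HJ problem: $u^\alpha_t+H_\alpha(u^\alpha_x)=0$ on $(0,T)\times(0,+\infty)$ for all $\alpha$; at $x=0$, $u^\beta=:u$ for all $\beta$ and $u_t+\max_\beta H_\beta^-(u^\beta_x)=0$ on $(0,T)\times\{0\}$; $u^\alpha(0,x)=u^\alpha_0(x)$. Viscosity solutions: an upper (resp. lower) semi-continuous function $u:[0,T)\times J\to\mathbb R$ is a viscosity subsolution (resp. supersolution) on $J_T$ if for any $P=(t,y)\in J_T$ and $\varphi\in C^1_*(J_T)$ such that $u\le\varphi$ (resp. $u\ge\varphi$) in a neighbourhood of $P$ with equality at $P$, one has $\varphi^\alpha_t(t,x)+H_\alpha(\varphi^\alpha_x(t,x))\le0$ (resp. $\ge0$) if $y=xe_\alpha\in J_\alpha^*$, and $\varphi_t(t,0)+\max_\alpha H_\alpha^-(\varphi_x^\alpha(t,0))\le0$ (resp. $\ge0$) if $y=0$. A function $u:[0,T)\times J\to\mathbb R$ is a viscosity solution of the problem with initial data $u_0$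 if its upper semi-continuous envelope $u^*$ is a subsolution with $u^*(0,\cdot)\le u_0$ on $J$ and its lower semi-continuous envelope $u_*$ is a supersolution with $u_*(0,\cdot)\ge u_0$ on $J$. Solutions considered are continuous functions on $[0,T)\times J$. Scheme (steps $\Delta t,\Delta x>0$): with $p^{\alpha,n}_{i,+}=\frac{U^{\alpha,n}_{i+1}-U^{\alpha,n}_i}{\Delta x}$, $p^{\alpha,n}_{i,-}=\frac{U^{\alpha,n}_i-U^{\alpha,n}_{i-1}}{\Delta x}$, $W^{\alpha,n}_i=\frac{U^{\alpha,n+1}_i-U^{\alpha,n}_i}{\Delta t}$, for all $n\ge0$: $W^{\alpha,n}_i+\max\{H_\alpha^+(p^{\alpha,n}_{i,-}),H_\alpha^-(p^{\alpha,n}_{i,+})\}=0$ for $i\ge1$; at $i=0$, $U^{\beta,n}_0=:U^n_0$ for all $\beta$ and $\frac{U^{n+1}_0-U^n_0}{\Delta t}+\max_\beta H_\beta^-(p^{\beta,n}_{0,+})=0$. CFL condition: $\frac{\Delta x}{\Delta t}\ge\sup_{\alpha,\ p\in[\underline p_\alpha,\overline p_\alpha]}|H_\alpha'(p)|$, where $\underline p_\alpha=(H_\alpha^-)^{-1}(-m^0)$, $\overline p_\alpha=(H_\alpha^+)^{-1}(-m^0)$, $m^0=\inf_{\beta,\,i\ge0}W^{\beta,0}_i$ (these depend on $\Delta x$ but not on $\Delta t$). *)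

theory Defs
  imports "HOL-Analysis.Analysis"
begin

text \<open>
  The \<open>N\<close> branches are indexed by an arbitrary finite type \<open>'n\<close>, so that \<open>N = CARD('n) \<ge> 1\<close>.
  Functions of \<open>(t, y)\<close> with \<open>y\<close> in the junction are total functions on \<open>real \<times> (real^2)\<close>
  of which only the values on the stated domain are ever used.
\<close>

definition junction_dirs :: "('n::finite \<Rightarrow> real^2) \<Rightarrow> bool" where
  "junction_dirs e \<longleftrightarrow> inj e \<and> (\<forall>\<alpha>. norm (e \<alpha>) = 1)"

definition half_line :: "('n::finite \<Rightarrow> real^2) \<Rightarrow> 'n \<Rightarrow> (real^2) set" where
  "half_line e \<alpha> = (\<lambda>x. x *\<^sub>R e \<alpha>) ` {0..}"

definition junction :: "('n::finite \<Rightarrow> real^2) \<Rightarrow> (real^2) set" where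
  "junction e = (\<Union>\<alpha>. half_line e \<alpha>)"

definition open_dom :: "('n::finite \<Rightarrow> real^2) \<Rightarrow> real \<Rightarrow> (real \<times> (real^2)) set" where
  "open_dom e T = {0<..<T} \<times> junction e"

definition full_dom :: "('n::finite \<Rightarrow> real^2) \<Rightarrow> real \<Rightarrow> (real \<times> (real^2)) set" where
  "full_dom e T = {0..<T} \<times> junction e"

definition branch ::
    "('n::finite \<Rightarrow> real^2) \<Rightarrow> (real \<times> (real^2) \<Rightarrow> 'a) \<Rightarrow> 'n \<Rightarrow> real \<Rightarrow> real \<Rightarrow> 'a" where
  "branch e u \<alpha> t x = u (t, x *\<^sub>R e \<alpha>)"

definition time_deriv ::
    "('n::finite \<Rightarrow> real^2) \<Rightarrow> (real \<times> (real^2) \<Rightarrow> real) \<Rightarrow> 'n \<Rightarrow> real \<Rightarrow> real \<Rightarrow> real" where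
  "time_deriv e \<phi> \<alpha> t x = vector_derivative (\<lambda>s. branch e \<phi> \<alpha> s x) (at t)"

text \<open>The derivative along the branch is one-sided at the vertex \<open>x = 0\<close>.\<close>

definition space_deriv ::
    "('n::finite \<Rightarrow> real^2) \<Rightarrow> (real \<times> (real^2) \<Rightarrow> real) \<Rightarrow> 'n \<Rightarrow> real \<Rightarrow> real \<Rightarrow> real" where
  "space_deriv e \<phi> \<alpha> t x = vector_derivative (\<lambda>y. branch e \<phi> \<alpha> t y) (at x within {0..})"

definition C1_star :: "('n::finite \<Rightarrow> real^2) \<Rightarrow> real \<Rightarrow> (real \<times> (real^2) \<Rightarrow> real) set" where
  "C1_star e T = {\<phi>. continuous_on (open_dom e T) \<phi> \<and>
     (\<forall>\<alpha>. (\<forall>t\<in>{0<..<T}. \<forall>x\<in>{0..}.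
              (\<lambda>s. branch e \<phi> \<alpha> s x) differentiable (at t) \<and>
              (\<lambda>y. branch e \<phi> \<alpha> t y) differentiable (at x within {0..})) \<and>
          continuous_on ({0<..<T} \<times> {0..}) (\<lambda>(t, x). time_deriv e \<phi> \<alpha> t x) \<and>
          continuous_on ({0<..<T} \<times> {0..}) (\<lambda>(t, x). space_deriv e \<phi> \<alpha> t x))}"

definition A0 :: "('n::finite \<Rightarrow> real \<Rightarrow> real) \<Rightarrow> bool" where
  "A0 u0 \<longleftrightarrow> (\<forall>\<alpha>. \<exists>C. C-lipschitz_on {0..} (u0 \<alpha>)) \<and> (\<forall>\<alpha> \<beta>. u0 \<alpha> 0 = u0 \<beta> 0)"

definition decr_incr_at :: "(real \<Rightarrow> real) \<Rightarrow> real \<Rightarrow> bool" where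
  "decr_incr_at h q \<longleftrightarrow> antimono_on {..q} h \<and> mono_on {q..} h"

text \<open>The last clause, uniqueness of \<open>p0\<close>, says that there is no plateau at the minimum.\<close>

definition A1 :: "('n::finite \<Rightarrow> real \<Rightarrow> real) \<Rightarrow> ('n \<Rightarrow> real) \<Rightarrow> bool" where
  "A1 H p0 \<longleftrightarrow> (\<forall>\<alpha>. H \<alpha> C1_differentiable_on UNIV \<and>
     filterlim (H \<alpha>) at_top at_infinity \<and>
     decr_incr_at (H \<alpha>) (p0 \<alpha>) \<and>
     (\<forall>q. decr_incr_at (H \<alpha>) q \<longrightarrow> q = p0 \<alpha>))"

definition Hminus :: "('n::finite \<Rightarrow> real \<Rightarrow> real) \<Rightarrow> ('n \<Rightarrow> real) \<Rightarrow> 'n \<Rightarrow> real \<Rightarrow> real" where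
  "Hminus H p0 \<alpha> p = (if p \<le> p0 \<alpha> then H \<alpha> p else H \<alpha> (p0 \<alpha>))"

definition Hplus :: "('n::finite \<Rightarrow> real \<Rightarrow> real) \<Rightarrow> ('n \<Rightarrow> real) \<Rightarrow> 'n \<Rightarrow> real \<Rightarrow> real" where
  "Hplus H p0 \<alpha> p = (if p \<le> p0 \<alpha> then H \<alpha> (p0 \<alpha>) else H \<alpha> p)"

text \<open>
  The generalized inverses are extended-real valued to accommodate their values at \<open>\<infinity>\<close>;
  under \<open>A1\<close> they are finite at every real value attained.
\<close>

definition Hminus_inv ::
    "('n::finite \<Rightarrow> real \<Rightarrow> real) \<Rightarrow> ('n \<Rightarrow> real) \<Rightarrow> 'n \<Rightarrow> ereal \<Rightarrow> ereal" where
  "Hminus_inv H p0 \<alpha> a =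
     (if a = \<infinity> then -\<infinity> else Inf (ereal ` {p. ereal (Hminus H p0 \<alpha> p) = a}))"

definition Hplus_inv ::
    "('n::finite \<Rightarrow> real \<Rightarrow> real) \<Rightarrow> ('n \<Rightarrow> real) \<Rightarrow> 'n \<Rightarrow> ereal \<Rightarrow> ereal" where
  "Hplus_inv H p0 \<alpha> a =
     (if a = \<infinity> then \<infinity> else Sup (ereal ` {p. ereal (Hplus H p0 \<alpha> p) = a}))"

text \<open>
  The filter \<open>inf (nhds P) (principal D)\<close> keeps the point \<open>P\<close> itself, unlike \<open>at P within D\<close>.
  Envelopes are a priori extended-real valued; sub- and supersolutions are required to be finite.
\<close>

definition usc_env :: "('a::topological_space) set \<Rightarrow> ('a \<Rightarrow> real) \<Rightarrow> 'a \<Rightarrow> ereal" where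
  "usc_env D u P = Limsup (inf (nhds P) (principal D)) (\<lambda>Q. ereal (u Q))"

definition lsc_env :: "('a::topological_space) set \<Rightarrow> ('a \<Rightarrow> real) \<Rightarrow> 'a \<Rightarrow> ereal" where
  "lsc_env D u P = Liminf (inf (nhds P) (principal D)) (\<lambda>Q. ereal (u Q))"

definition usc_on :: "('a::topological_space) set \<Rightarrow> ('a \<Rightarrow> ereal) \<Rightarrow> bool" where
  "usc_on D v \<longleftrightarrow> (\<forall>P\<in>D. Limsup (at P within D) v \<le> v P)"

definition lsc_on :: "('a::topological_space) set \<Rightarrow> ('a \<Rightarrow> ereal) \<Rightarrow> bool" where
  "lsc_on D v \<longleftrightarrow> (\<forall>P\<in>D. v P \<le> Liminf (at P within D) v)"

definition touches_from_above ::
    "('n::finite \<Rightarrow> real^2) \<Rightarrow> real \<Rightarrow> (real \<times> (real^2) \<Rightarrow> real) \<Rightarrow>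
     (real \<times> (real^2) \<Rightarrow> ereal) \<Rightarrow> real \<times> (real^2) \<Rightarrow> bool" where
  "touches_from_above e T \<phi> v P \<longleftrightarrow>
     (\<forall>\<^sub>F Q in at P within open_dom e T. v Q \<le> ereal (\<phi> Q)) \<and> v P = ereal (\<phi> P)"

definition touches_from_below ::
    "('n::finite \<Rightarrow> real^2) \<Rightarrow> real \<Rightarrow> (real \<times> (real^2) \<Rightarrow> real) \<Rightarrow>
     (real \<times> (real^2) \<Rightarrow> ereal) \<Rightarrow> real \<times> (real^2) \<Rightarrow> bool" where
  "touches_from_below e T \<phi> v P \<longleftrightarrow>
     (\<forall>\<^sub>F Q in at P within open_dom e T. v Q \<ge> ereal (\<phi> Q)) \<and> v P = ereal (\<phi> P)"

definition branch_operator ::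
    "('n::finite \<Rightarrow> real^2) \<Rightarrow> ('n \<Rightarrow> real \<Rightarrow> real) \<Rightarrow>
     (real \<times> (real^2) \<Rightarrow> real) \<Rightarrow> 'n \<Rightarrow> real \<Rightarrow> real \<Rightarrow> real" where
  "branch_operator e H \<phi> \<alpha> t x = time_deriv e \<phi> \<alpha> t x + H \<alpha> (space_deriv e \<phi> \<alpha> t x)"

definition vertex_operator ::
    "('n::finite \<Rightarrow> real^2) \<Rightarrow> ('n \<Rightarrow> real \<Rightarrow> real) \<Rightarrow> ('n \<Rightarrow> real) \<Rightarrow>
     (real \<times> (real^2) \<Rightarrow> real) \<Rightarrow> real \<Rightarrow> real" where
  "vertex_operator e H p0 \<phi> t =
     vector_derivative (\<lambda>s. \<phi> (s, 0)) (at t) + (MAX \<alpha>. Hminus H p0 \<alpha> (space_deriv e \<phi> \<alpha> t 0))"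

definition viscosity_subsolution ::
    "('n::finite \<Rightarrow> real^2) \<Rightarrow> real \<Rightarrow> ('n \<Rightarrow> real \<Rightarrow> real) \<Rightarrow> ('n \<Rightarrow> real) \<Rightarrow>
     (real \<times> (real^2) \<Rightarrow> ereal) \<Rightarrow> bool" where
  "viscosity_subsolution e T H p0 v \<longleftrightarrow>
     (\<forall>P\<in>full_dom e T. \<bar>v P\<bar> \<noteq> \<infinity>) \<and> usc_on (full_dom e T) v \<and>
     (\<forall>\<phi>\<in>C1_star e T. \<forall>t\<in>{0<..<T}.
        (\<forall>\<alpha>. \<forall>x>0. touches_from_above e T \<phi> v (t, x *\<^sub>R e \<alpha>) \<longrightarrow> branch_operator e H \<phi> \<alpha> t x \<le> 0) \<and>
        (touches_from_above e T \<phi> v (t, 0) \<longrightarrow> vertex_operator e H p0 \<phi> t \<le> 0))"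

definition viscosity_supersolution ::
    "('n::finite \<Rightarrow> real^2) \<Rightarrow> real \<Rightarrow> ('n \<Rightarrow> real \<Rightarrow> real) \<Rightarrow> ('n \<Rightarrow> real) \<Rightarrow>
     (real \<times> (real^2) \<Rightarrow> ereal) \<Rightarrow> bool" where
  "viscosity_supersolution e T H p0 v \<longleftrightarrow>
     (\<forall>P\<in>full_dom e T. \<bar>v P\<bar> \<noteq> \<infinity>) \<and> lsc_on (full_dom e T) v \<and>
     (\<forall>\<phi>\<in>C1_star e T. \<forall>t\<in>{0<..<T}.
        (\<forall>\<alpha>. \<forall>x>0. touches_from_below e T \<phi> v (t, x *\<^sub>R e \<alpha>) \<longrightarrow> branch_operator e H \<phi> \<alpha> t x \<ge> 0) \<and>
        (touches_from_below e T \<phi> v (t, 0) \<longrightarrow> vertex_operator e H p0 \<phi> t \<ge> 0))"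

definition viscosity_solution ::
    "('n::finite \<Rightarrow> real^2) \<Rightarrow> real \<Rightarrow> ('n \<Rightarrow> real \<Rightarrow> real) \<Rightarrow> ('n \<Rightarrow> real) \<Rightarrow>
     ('n \<Rightarrow> real \<Rightarrow> real) \<Rightarrow> (real \<times> (real^2) \<Rightarrow> real) \<Rightarrow> bool" where
  "viscosity_solution e T H p0 u0 u \<longleftrightarrow>
     viscosity_subsolution e T H p0 (usc_env (full_dom e T) u) \<and>
     (\<forall>\<alpha>. \<forall>x\<ge>0. branch e (usc_env (full_dom e T) u) \<alpha> 0 x \<le> ereal (u0 \<alpha> x)) \<and>
     viscosity_supersolution e T H p0 (lsc_env (full_dom e T) u) \<and>
     (\<forall>\<alpha>. \<forall>x\<ge>0. branch e (lsc_env (full_dom e T) u) \<alpha> 0 x \<ge> ereal (u0 \<alpha> x))"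

text \<open>\<open>U \<alpha> n i\<close> is the value at time step \<open>n\<close> and node \<open>i\<close> of branch \<open>\<alpha>\<close>.\<close>

type_synonym 'n grid_fun = "'n \<Rightarrow> nat \<Rightarrow> nat \<Rightarrow> real"

definition W :: "real \<Rightarrow> 'n::finite grid_fun \<Rightarrow> 'n grid_fun" where
  "W \<Delta>t U \<alpha> n i = (U \<alpha> (n + 1) i - U \<alpha> n i) / \<Delta>t"

definition grad_plus :: "real \<Rightarrow> 'n::finite grid_fun \<Rightarrow> 'n grid_fun" where
  "grad_plus \<Delta>x U \<alpha> n i = (U \<alpha> n (i + 1) - U \<alpha> n i) / \<Delta>x"

text \<open>Only used at nodes \<open>i \<ge> 1\<close>, where the truncated subtraction is harmless.\<close>

definition grad_minus :: "real \<Rightarrow> 'n::finite grid_fun \<Rightarrow> 'n grid_fun" where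
  "grad_minus \<Delta>x U \<alpha> n i = (U \<alpha> n i - U \<alpha> n (i - 1)) / \<Delta>x"

definition scheme ::
    "('n::finite \<Rightarrow> real \<Rightarrow> real) \<Rightarrow> ('n \<Rightarrow> real) \<Rightarrow> real \<Rightarrow> real \<Rightarrow> 'n grid_fun \<Rightarrow> bool" where
  "scheme H p0 \<Delta>t \<Delta>x U \<longleftrightarrow> (\<forall>n.
     (\<forall>\<alpha>. \<forall>i\<ge>1. W \<Delta>t U \<alpha> n i +
        max (Hplus H p0 \<alpha> (grad_minus \<Delta>x U \<alpha> n i)) (Hminus H p0 \<alpha> (grad_plus \<Delta>x U \<alpha> n i)) = 0) \<and>
     (\<forall>\<alpha> \<beta>. U \<alpha> n 0 = U \<beta> n 0) \<and>
     (\<forall>\<alpha>. W \<Delta>t U \<alpha> n 0 + (MAX \<beta>. Hminus H p0 \<beta> (grad_plus \<Delta>x U \<beta> n 0)) = 0))"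

definition numerical_solution ::
    "('n::finite \<Rightarrow> real \<Rightarrow> real) \<Rightarrow> ('n \<Rightarrow> real) \<Rightarrow> ('n \<Rightarrow> real \<Rightarrow> real) \<Rightarrow>
     real \<Rightarrow> real \<Rightarrow> 'n grid_fun \<Rightarrow> bool" where
  "numerical_solution H p0 u0 \<Delta>t \<Delta>x U \<longleftrightarrow>
     (\<forall>\<alpha> i. U \<alpha> 0 i = u0 \<alpha> (real i * \<Delta>x)) \<and> scheme H p0 \<Delta>t \<Delta>x U"

definition m0 :: "real \<Rightarrow> 'n::finite grid_fun \<Rightarrow> ereal" where
  "m0 \<Delta>t U = (INF (\<beta>, i)\<in>UNIV. ereal (W \<Delta>t U \<beta> 0 i))"

definition CFL ::
    "('n::finite \<Rightarrow> real \<Rightarrow> real) \<Rightarrow> ('n \<Rightarrow> real) \<Rightarrow> real \<Rightarrow> real \<Rightarrow> 'n grid_fun \<Rightarrow> bool" where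
  "CFL H p0 \<Delta>t \<Delta>x U \<longleftrightarrow>
     (SUP (\<alpha>, p)\<in>{(\<alpha>, p). Hminus_inv H p0 \<alpha> (- m0 \<Delta>t U) \<le> ereal p \<and>
                             ereal p \<le> Hplus_inv H p0 \<alpha> (- m0 \<Delta>t U)}. ereal \<bar>deriv (H \<alpha>) p\<bar>)
     \<le> ereal (\<Delta>x / \<Delta>t)"

text \<open>The supremum is taken in \<open>ennreal\<close>, so that it is \<open>0\<close> when no grid point lies in \<open>K\<close>.\<close>

definition scheme_converges ::
    "('n::finite \<Rightarrow> real^2) \<Rightarrow> real \<Rightarrow> (nat \<Rightarrow> real) \<Rightarrow> (nat \<Rightarrow> real) \<Rightarrow>
     (nat \<Rightarrow> 'n grid_fun) \<Rightarrow> (real \<times> (real^2) \<Rightarrow> real) \<Rightarrow> bool" where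
  "scheme_converges e T \<Delta>t \<Delta>x U u \<longleftrightarrow> (\<forall>K. compact K \<longrightarrow> K \<subseteq> full_dom e T \<longrightarrow>
     (\<lambda>k. SUP (\<alpha>, n, i)\<in>{(\<alpha>, n, i). (real n * \<Delta>t k, (real i * \<Delta>x k) *\<^sub>R e \<alpha>) \<in> K}.
        ennreal \<bar>branch e u \<alpha> (real n * \<Delta>t k) (real i * \<Delta>x k) - U k \<alpha> n i\<bar>)
     \<longlonglongrightarrow> 0)"

definition Lminus :: "('n::finite \<Rightarrow> real \<Rightarrow> real) \<Rightarrow> 'n \<Rightarrow> real" where
  "Lminus u0 \<alpha> = (GREATEST L. \<forall>x\<ge>0. \<forall>a\<ge>0. a * L \<le> u0 \<alpha> (x + a) - u0 \<alpha> x)"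

definition Lplus :: "('n::finite \<Rightarrow> real \<Rightarrow> real) \<Rightarrow> 'n \<Rightarrow> real" where
  "Lplus u0 \<alpha> = (LEAST L. \<forall>x\<ge>0. \<forall>a\<ge>0. u0 \<alpha> (x + a) - u0 \<alpha> x \<le> a * L)"

definition m00 :: "('n::finite \<Rightarrow> real \<Rightarrow> real) \<Rightarrow> ('n \<Rightarrow> real \<Rightarrow> real) \<Rightarrow> real" where
  "m00 H u0 = (INF (\<alpha>, p)\<in>{(\<alpha>, p). Lminus u0 \<alpha> \<le> p \<and> p \<le> Lplus u0 \<alpha>}. - H \<alpha> p)"

definition M00 ::
    "('n::finite \<Rightarrow> real \<Rightarrow> real) \<Rightarrow> ('n \<Rightarrow> real) \<Rightarrow> ('n \<Rightarrow> real \<Rightarrow> real) \<Rightarrow> real" where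
  "M00 H p0 u0 =
     max (MAX \<alpha>. - max (Hminus H p0 \<alpha> (Lplus u0 \<alpha>)) (Hplus H p0 \<alpha> (Lminus u0 \<alpha>)))
         (- (MAX \<alpha>. Hminus H p0 \<alpha> (Lplus u0 \<alpha>)))"

definition p_low ::
    "('n::finite \<Rightarrow> real \<Rightarrow> real) \<Rightarrow> ('n \<Rightarrow> real) \<Rightarrow> ('n \<Rightarrow> real \<Rightarrow> real) \<Rightarrow> 'n \<Rightarrow> ereal" where
  "p_low H p0 u0 \<alpha> = Hminus_inv H p0 \<alpha> (ereal (- m00 H u0))"

definition p_up ::
    "('n::finite \<Rightarrow> real \<Rightarrow> real) \<Rightarrow> ('n \<Rightarrow> real) \<Rightarrow> ('n \<Rightarrow> real \<Rightarrow> real) \<Rightarrow> 'n \<Rightarrow> ereal" where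
  "p_up H p0 u0 \<alpha> = Hplus_inv H p0 \<alpha> (ereal (- m00 H u0))"

end

theory Submission
  imports Defs
begin

text \<open>
  The scheme reads \<open>W = - flux\<close> with a flux that commutes with adding constants. A flux \<open>\<le> - m\<close>
  everywhere forces every discrete gradient into \<open>[(H\<^sup>-)\<inverse>(- m), (H\<^sup>+)\<inverse>(- m)]\<close>. Under the CFL
  condition one time step preserves order there, so by comparison with the solution shifted by
  \<open>m \<Delta>t\<close> or \<open>M \<Delta>t\<close>, two-sided bounds on \<open>W\<close> at the initial time propagate to all times. The best
  Lipschitz constants of \<open>u0\<close> give such bounds uniformly in the steps, and the estimates pass to
  the limit along the grid points \<open>(\<lfloor>t / \<Delta>t\<rfloor>, \<lfloor>x / \<Delta>x\<rfloor>)\<close>.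
\<close>

section \<open>Monotone envelopes of the Hamiltonians and their generalized inverses\<close>

lemma Hminus_eq_min: "Hminus H p0 \<alpha> p = H \<alpha> (min p (p0 \<alpha>))"
  by (simp add: Hminus_def min_def)

lemma Hplus_eq_max: "Hplus H p0 \<alpha> p = H \<alpha> (max p (p0 \<alpha>))"
  by (simp add: Hplus_def max_def)

lemma A1_D:
  assumes "A1 H p0"
  shows A1_continuous: "continuous_on S (H \<alpha>)"
    and A1_DERIV: "(H \<alpha> has_real_derivative deriv (H \<alpha>) p) (at p)"
    and A1_at_top: "filterlim (H \<alpha>) at_top at_top"
    and A1_at_bot: "filterlim (H \<alpha>) at_top at_bot"
    and A1_decreasing: "p \<le> q \<Longrightarrow> q \<le> p0 \<alpha> \<Longrightarrow> H \<alpha> q \<le> H \<alpha> p"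
    and A1_increasing: "p0 \<alpha> \<le> p \<Longrightarrow> p \<le> q \<Longrightarrow> H \<alpha> p \<le> H \<alpha> q"
proof -
  have C1: "H \<alpha> C1_differentiable_on UNIV" and lim: "filterlim (H \<alpha>) at_top at_infinity"
    and di: "decr_incr_at (H \<alpha>) (p0 \<alpha>)"
    using assms by (auto simp: A1_def)
  have diff: "H \<alpha> differentiable at p" for p
    using C1 by (auto simp: C1_differentiable_on_eq)
  show der: "(H \<alpha> has_real_derivative deriv (H \<alpha>) p) (at p)" for p
    using diff DERIV_deriv_iff_real_differentiable by blast
  show "continuous_on S (H \<alpha>)"
    using der DERIV_isCont continuous_at_imp_continuous_on by blast
  show "filterlim (H \<alpha>) at_top at_top"
    using lim filterlim_mono at_top_le_at_infinity by blast
  show "filterlim (H \<alpha>) at_top at_bot"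
    using lim filterlim_mono at_bot_le_at_infinity by blast
  show "H \<alpha> q \<le> H \<alpha> p" if "p \<le> q" "q \<le> p0 \<alpha>"
    using di that by (auto simp: decr_incr_at_def monotone_on_def)
  show "H \<alpha> p \<le> H \<alpha> q" if "p0 \<alpha> \<le> p" "p \<le> q"
    using di that by (auto simp: decr_incr_at_def monotone_on_def)
qed

lemma A1_minimum:
  assumes "A1 H p0"
  shows "H \<alpha> (p0 \<alpha>) \<le> H \<alpha> p"
  using A1_increasing[OF assms, of \<alpha> "p0 \<alpha>" p] A1_decreasing[OF assms, of p "p0 \<alpha>" \<alpha>]
  by (cases "p \<le> p0 \<alpha>") auto

lemma Hminus_antimono: "A1 H p0 \<Longrightarrow> p \<le> q \<Longrightarrow> Hminus H p0 \<alpha> q \<le> Hminus H p0 \<alpha> p"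
  by (simp add: Hminus_eq_min A1_decreasing min.coboundedI1 min.mono)

lemma Hplus_mono: "A1 H p0 \<Longrightarrow> p \<le> q \<Longrightarrow> Hplus H p0 \<alpha> p \<le> Hplus H p0 \<alpha> q"
  by (simp add: Hplus_eq_max A1_increasing max.coboundedI1 max.mono)

lemma Hminus_le: "A1 H p0 \<Longrightarrow> Hminus H p0 \<alpha> p \<le> H \<alpha> p"
  using A1_minimum by (auto simp: Hminus_def)

lemma Hplus_le: "A1 H p0 \<Longrightarrow> Hplus H p0 \<alpha> p \<le> H \<alpha> p"
  using A1_minimum by (auto simp: Hplus_def)

text \<open>The level \<open>a\<close> is attained by the intermediate value theorem, and its level
  set is closed and bounded above, so the supremum \<open>r\<close> is itself attained. By
  monotonicity \<open>r\<close> bounds the whole sublevel set and not only the level set; this is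
  what later turns bounds on the flux into bounds on gradients.\<close>

lemma Sup_level_set:
  fixes h :: "real \<Rightarrow> real"
  assumes cont: "continuous_on UNIV h" and mono: "\<And>p q. p \<le> q \<Longrightarrow> h p \<le> h q"
    and lim: "filterlim h at_top at_top" and q: "h q \<le> a"
  obtains r where "Sup (ereal ` {p. ereal (h p) = ereal a}) = ereal r" "h r = a"
    "\<And>p. h p \<le> a \<Longrightarrow> p \<le> r"
proof -
  define S where "S = {p. h p = a}"
  have "\<forall>\<^sub>F x in at_top. a < h x"
    using lim by (simp add: filterlim_at_top_dense)
  then obtain b where b: "\<And>x. b \<le> x \<Longrightarrow> a < h x"
    by (auto simp: eventually_at_top_linorder)
  have "\<exists>x. q \<le> x \<and> x \<le> max b q \<and> h x = a"
    using b[of "max b q"] q continuous_on_subset[OF cont] by (intro IVT') auto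
  then have ne: "S \<noteq> {}"
    by (auto simp: S_def)
  have "x \<le> b" if "x \<in> S" for x
    using b[of x] that by (cases "b \<le> x") (auto simp: S_def)
  then have bdd: "bdd_above S"
    by (rule bdd_aboveI)
  have "closed S"
    unfolding S_def using cont by (intro closed_Collect_eq) auto
  then have SupS: "Sup S \<in> S"
    using ne bdd by (intro closed_contains_Sup)
  \<comment> \<open>A point of the sublevel set beyond \<open>Sup S\<close> would take the value
    \<open>a\<close> by monotonicity, so it would belong to \<open>S\<close>.\<close>
  have upper: "p \<le> Sup S" if "h p \<le> a" for p
  proof (rule ccontr)
    assume "\<not> p \<le> Sup S"
    then have "h (Sup S) \<le> h p"
      by (intro mono) auto
    then have "p \<in> S"
      using SupS that by (auto simp: S_def)
    with \<open>\<not> p \<le> Sup S\<close> show False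
      using bdd cSup_upper by blast
  qed
  show thesis
  proof (rule that[of "Sup S"])
    show "Sup (ereal ` {p. ereal (h p) = ereal a}) = ereal (Sup S)"
      using SupS upper by (intro Sup_eqI) (auto simp: S_def)
  qed (use SupS upper in \<open>auto simp: S_def\<close>)
qed

text \<open>A level at or above the minimum of \<open>H \<alpha>\<close> is attained, so there the
  extended-real inverse is a real number.\<close>

lemma Hplus_inv_real:
  assumes "A1 H p0" "H \<alpha> (p0 \<alpha>) \<le> a"
  obtains r where "Hplus_inv H p0 \<alpha> (ereal a) = ereal r" "Hplus H p0 \<alpha> r = a"
    "\<And>p. Hplus H p0 \<alpha> p \<le> a \<Longrightarrow> p \<le> r"
proof -
  have "continuous_on UNIV (Hplus H p0 \<alpha>)"
    unfolding Hplus_eq_max[abs_def]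
    by (rule continuous_on_compose2[OF A1_continuous[OF assms(1)]]) (auto intro!: continuous_intros)
  moreover have "filterlim (Hplus H p0 \<alpha>) at_top at_top"
    using A1_at_top[OF assms(1)]
    by (rule filterlim_mono_eventually[where f = "H \<alpha>"])
      (auto intro!: eventually_mono[OF eventually_gt_at_top[of "p0 \<alpha>"]] simp: Hplus_def)
  moreover have "Hplus H p0 \<alpha> (p0 \<alpha>) \<le> a"
    using assms(2) by (simp add: Hplus_def)
  ultimately show thesis
    using Hplus_mono[OF assms(1)] that
    by (rule_tac Sup_level_set[of "Hplus H p0 \<alpha>" "p0 \<alpha>" a]) (auto simp: Hplus_inv_def)
qed

text \<open>Mirror image of the previous case: \<open>Hminus\<close> composed with negation is
  nondecreasing, and the greatest point of its level set becomes the smallest one after the sign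
  change.\<close>

lemma Hminus_inv_real:
  assumes "A1 H p0" "H \<alpha> (p0 \<alpha>) \<le> a"
  obtains r where "Hminus_inv H p0 \<alpha> (ereal a) = ereal r" "Hminus H p0 \<alpha> r = a"
    "\<And>p. Hminus H p0 \<alpha> p \<le> a \<Longrightarrow> r \<le> p"
proof -
  define h where "h p = Hminus H p0 \<alpha> (- p)" for p
  have "continuous_on UNIV h"
    unfolding h_def Hminus_eq_min
    by (rule continuous_on_compose2[OF A1_continuous[OF assms(1)]]) (auto intro!: continuous_intros)
  moreover have "filterlim h at_top at_top"
  proof -
    have "filterlim (\<lambda>p. H \<alpha> (- p)) at_top at_top"
      using A1_at_bot[OF assms(1)] by (simp add: filterlim_at_bot_mirror)
    then show ?thesis
      by (rule filterlim_mono_eventually)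
        (auto intro!: eventually_mono[OF eventually_gt_at_top[of "- p0 \<alpha>"]] simp: h_def Hminus_def)
  qed
  moreover have "h (- p0 \<alpha>) \<le> a"
    using assms(2) by (simp add: h_def Hminus_def)
  moreover have "p \<le> q \<Longrightarrow> h p \<le> h q" for p q
    using Hminus_antimono[OF assms(1)] by (simp add: h_def)
  ultimately obtain r where r: "h r = a" "\<And>p. h p \<le> a \<Longrightarrow> p \<le> r"
    using Sup_level_set by metis
  have lower: "- r \<le> p" if "Hminus H p0 \<alpha> p \<le> a" for p
    using r(2)[of "- p"] that by (simp add: h_def)
  show thesis
  proof (rule that[of "- r"])
    show "Hminus_inv H p0 \<alpha> (ereal a) = ereal (- r)"
      using r(1) lower unfolding Hminus_inv_def
      by (auto intro!: Inf_eqI simp: h_def simp del: uminus_ereal.simps)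
  qed (use r lower in \<open>auto simp: h_def\<close>)
qed

section \<open>The numerical flux and its monotonicity\<close>

text \<open>The two envelopes are parameters because the same formula is needed for modified
  versions of \<open>Hminus\<close> and \<open>Hplus\<close>. At the vertex the value is the same on
  every branch.\<close>

definition num_flux ::
    "('n::finite \<Rightarrow> real \<Rightarrow> real) \<Rightarrow> ('n \<Rightarrow> real \<Rightarrow> real) \<Rightarrow> real \<Rightarrow> ('n \<Rightarrow> nat \<Rightarrow> real) \<Rightarrow> 'n \<Rightarrow> nat \<Rightarrow> real" where
  "num_flux F G \<Delta>x v \<alpha> i =
     (if i = 0 then MAX \<beta>. F \<beta> ((v \<beta> 1 - v \<beta> 0) / \<Delta>x)
      else max (G \<alpha> ((v \<alpha> i - v \<alpha> (i - 1)) / \<Delta>x)) (F \<alpha> ((v \<alpha> (i + 1) - v \<alpha> i) / \<Delta>x)))"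

lemma W_eq_num_flux:
  assumes "scheme H p0 \<Delta>t \<Delta>x U"
  shows "W \<Delta>t U \<alpha> n i = - num_flux (Hminus H p0) (Hplus H p0) \<Delta>x (\<lambda>\<alpha>. U \<alpha> n) \<alpha> i"
proof (cases "i = 0")
  case True
  have "W \<Delta>t U \<alpha> n 0 + (MAX \<beta>. Hminus H p0 \<beta> (grad_plus \<Delta>x U \<beta> n 0)) = 0"
    using assms unfolding scheme_def by blast
  then have "W \<Delta>t U \<alpha> n 0 = - (MAX \<beta>. Hminus H p0 \<beta> (grad_plus \<Delta>x U \<beta> n 0))"
    by linarith
  then show ?thesis
    using True by (simp add: num_flux_def grad_plus_def)
next
  case False
  then have "W \<Delta>t U \<alpha> n i +
      max (Hplus H p0 \<alpha> (grad_minus \<Delta>x U \<alpha> n i)) (Hminus H p0 \<alpha> (grad_plus \<Delta>x U \<alpha> n i)) = 0"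
    using assms unfolding scheme_def by simp
  then show ?thesis
    using False by (simp add: num_flux_def grad_plus_def grad_minus_def eq_neg_iff_add_eq_0)
qed

text \<open>A backward difference at \<open>i\<close> is the forward difference at
  \<open>i - 1\<close>, so agreement on the forward differences of \<open>v\<close> covers every
  argument that occurs.\<close>

lemma num_flux_cong:
  assumes "\<And>\<alpha> i. F \<alpha> ((v \<alpha> (i + 1) - v \<alpha> i) / \<Delta>x) = F' \<alpha> ((v \<alpha> (i + 1) - v \<alpha> i) / \<Delta>x)"
    and "\<And>\<alpha> i. G \<alpha> ((v \<alpha> (i + 1) - v \<alpha> i) / \<Delta>x) = G' \<alpha> ((v \<alpha> (i + 1) - v \<alpha> i) / \<Delta>x)"
  shows "num_flux F G \<Delta>x v \<alpha> i = num_flux F' G' \<Delta>x v \<alpha> i"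
  using assms(1)[of _ 0] assms(1)[of \<alpha> i] assms(2)[of \<alpha> "i - 1"]
  by (cases i) (simp_all add: num_flux_def)

text \<open>The flux is a maximum. The forward difference at \<open>i\<close> enters it through
  \<open>F\<close> at node \<open>i\<close> and through \<open>G\<close> at node
  \<open>i + 1\<close>, which is never the vertex.\<close>

lemma num_flux_gradient_le:
  assumes "\<And>\<alpha> i. num_flux F G \<Delta>x v \<alpha> i \<le> c"
  shows "F \<alpha> ((v \<alpha> (i + 1) - v \<alpha> i) / \<Delta>x) \<le> c"
    and "G \<alpha> ((v \<alpha> (i + 1) - v \<alpha> i) / \<Delta>x) \<le> c"
proof -
  show "F \<alpha> ((v \<alpha> (i + 1) - v \<alpha> i) / \<Delta>x) \<le> c"
    using assms[of \<alpha> i] by (cases "i = 0") (auto simp: num_flux_def)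
  show "G \<alpha> ((v \<alpha> (i + 1) - v \<alpha> i) / \<Delta>x) \<le> c"
    using assms[of \<alpha> "i + 1"] by (auto simp: num_flux_def)
qed

text \<open>Under the CFL bound on the slopes of \<open>F\<close> and \<open>G\<close>, this says that \<open>v \<mapsto> v - \<Delta>t * flux v\<close> is order preserving.\<close>

lemma num_flux_monotone:
  assumes pos: "\<Delta>t > 0" "\<Delta>x > 0"
    and F: "\<And>\<alpha> p q. p \<le> q \<Longrightarrow> F \<alpha> q \<le> F \<alpha> p \<and> F \<alpha> p \<le> F \<alpha> q + \<Delta>x / \<Delta>t * (q - p)"
    and G: "\<And>\<alpha> p q. p \<le> q \<Longrightarrow> G \<alpha> p \<le> G \<alpha> q \<and> G \<alpha> q \<le> G \<alpha> p + \<Delta>x / \<Delta>t * (q - p)"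
    and vertex: "\<And>\<alpha> \<beta>. v \<alpha> 0 = v \<beta> 0" "\<And>\<alpha> \<beta>. w \<alpha> 0 = w \<beta> 0"
    and le: "\<And>\<alpha> i. v \<alpha> i \<le> w \<alpha> i"
  shows "num_flux F G \<Delta>x w \<alpha> i \<le> num_flux F G \<Delta>x v \<alpha> i + (w \<alpha> i - v \<alpha> i) / \<Delta>t"
proof -
  have F': "F \<beta> ((w \<beta> (j + 1) - w \<beta> j) / \<Delta>x) \<le> F \<beta> ((v \<beta> (j + 1) - v \<beta> j) / \<Delta>x) + (w \<beta> j - v \<beta> j) / \<Delta>t" for \<beta> j
  proof -
    \<comment> \<open>This intermediate gradient allows one endpoint to change at a time: replacing
      \<open>w\<close> by \<open>v\<close> at the right node can only increase \<open>F\<close>, and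
      replacing it at the left node is paid for by the slope bound.\<close>
    let ?p = "(v \<beta> (j + 1) - w \<beta> j) / \<Delta>x"
    have "F \<beta> ((w \<beta> (j + 1) - w \<beta> j) / \<Delta>x) \<le> F \<beta> ?p"
      using F[of ?p "(w \<beta> (j + 1) - w \<beta> j) / \<Delta>x" \<beta>] le[of \<beta> "j + 1"] pos by (simp add: divide_right_mono)
    also have "\<dots> \<le> F \<beta> ((v \<beta> (j + 1) - v \<beta> j) / \<Delta>x) + \<Delta>x / \<Delta>t * ((v \<beta> (j + 1) - v \<beta> j) / \<Delta>x - ?p)"
      using F[of ?p "(v \<beta> (j + 1) - v \<beta> j) / \<Delta>x" \<beta>] le[of \<beta> j] pos by (simp add: divide_right_mono)
    also have "\<Delta>x / \<Delta>t * ((v \<beta> (j + 1) - v \<beta> j) / \<Delta>x - ?p) = (w \<beta> j - v \<beta> j) / \<Delta>t"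
      using pos by (simp add: field_simps)
    finally show ?thesis .
  qed
  have G': "G \<beta> ((w \<beta> (j + 1) - w \<beta> j) / \<Delta>x)
      \<le> G \<beta> ((v \<beta> (j + 1) - v \<beta> j) / \<Delta>x) + (w \<beta> (j + 1) - v \<beta> (j + 1)) / \<Delta>t" for \<beta> j
  proof -
    \<comment> \<open>For \<open>G\<close> the roles are exchanged: the left node is the free
      replacement, and the right node costs the increment.\<close>
    let ?p = "(w \<beta> (j + 1) - v \<beta> j) / \<Delta>x"
    have "G \<beta> ((w \<beta> (j + 1) - w \<beta> j) / \<Delta>x) \<le> G \<beta> ?p"
      using G[of "(w \<beta> (j + 1) - w \<beta> j) / \<Delta>x" ?p \<beta>] le[of \<beta> j] pos by (simp add: divide_right_mono)
    also have "\<dots> \<le> G \<beta> ((v \<beta> (j + 1) - v \<beta> j) / \<Delta>x) + \<Delta>x / \<Delta>t * (?p - (v \<beta> (j + 1) - v \<beta> j) / \<Delta>x)"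
      using G[of "(v \<beta> (j + 1) - v \<beta> j) / \<Delta>x" ?p \<beta>] le[of \<beta> "j + 1"] pos by (simp add: divide_right_mono)
    also have "\<Delta>x / \<Delta>t * (?p - (v \<beta> (j + 1) - v \<beta> j) / \<Delta>x) = (w \<beta> (j + 1) - v \<beta> (j + 1)) / \<Delta>t"
      using pos by (simp add: field_simps)
    finally show ?thesis .
  qed
  show ?thesis
  proof (cases "i = 0")
    case True
    have "F \<beta> ((w \<beta> 1 - w \<beta> 0) / \<Delta>x)
        \<le> (MAX \<beta>. F \<beta> ((v \<beta> 1 - v \<beta> 0) / \<Delta>x)) + (w \<alpha> 0 - v \<alpha> 0) / \<Delta>t" for \<beta>
    proof -
      have "F \<beta> ((v \<beta> 1 - v \<beta> 0) / \<Delta>x) \<le> (MAX \<beta>. F \<beta> ((v \<beta> 1 - v \<beta> 0) / \<Delta>x))"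
        by (intro Max_ge) auto
      \<comment> \<open>Since the vertex value is shared by all branches, the increment is the same
        for every \<open>\<beta>\<close> and can be pulled out of the maximum.\<close>
      moreover have "(w \<alpha> 0 - v \<alpha> 0) / \<Delta>t = (w \<beta> 0 - v \<beta> 0) / \<Delta>t"
        using vertex by metis
      ultimately show ?thesis
        using F'[of \<beta> 0, unfolded add_0] by linarith
    qed
    then show ?thesis
      using True by (simp add: num_flux_def)
  next
    case False
    then show ?thesis
      using F'[of \<alpha> i] G'[of \<alpha> "i - 1"] by (auto simp: num_flux_def)
  qed
qed

text \<open>The comparison function \<open>v'\<close> is \<open>v\<close> evolved with constant flux
  \<open>c\<close>; it differs from \<open>v\<close> by a constant, so it has the same flux. It lies
  below or above \<open>w\<close> according to the bound assumed, and in the monotonicity inequality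
  the increment \<open>(w - v') / \<Delta>t\<close>, which equals \<open>c\<close> minus the flux of
  \<open>v\<close>, leaves exactly \<open>c\<close>.\<close>

lemma num_flux_step:
  assumes pos: "\<Delta>t > 0" "\<Delta>x > 0"
    and F: "\<And>\<alpha> p q. p \<le> q \<Longrightarrow> F \<alpha> q \<le> F \<alpha> p \<and> F \<alpha> p \<le> F \<alpha> q + \<Delta>x / \<Delta>t * (q - p)"
    and G: "\<And>\<alpha> p q. p \<le> q \<Longrightarrow> G \<alpha> p \<le> G \<alpha> q \<and> G \<alpha> q \<le> G \<alpha> p + \<Delta>x / \<Delta>t * (q - p)"
    and vertex: "\<And>\<alpha> \<beta>. v \<alpha> 0 = v \<beta> 0" "\<And>\<alpha> \<beta>. w \<alpha> 0 = w \<beta> 0"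
    and w: "\<And>\<alpha> i. w \<alpha> i = v \<alpha> i - \<Delta>t * num_flux F G \<Delta>x v \<alpha> i"
  shows "(\<And>\<alpha> i. num_flux F G \<Delta>x v \<alpha> i \<le> c) \<Longrightarrow> num_flux F G \<Delta>x w \<alpha> i \<le> c"
    and "(\<And>\<alpha> i. c \<le> num_flux F G \<Delta>x v \<alpha> i) \<Longrightarrow> c \<le> num_flux F G \<Delta>x w \<alpha> i"
proof -
  define v' where "v' \<alpha> i = v \<alpha> i - \<Delta>t * c" for \<alpha> i
  have shift: "num_flux F G \<Delta>x v' \<alpha> i = num_flux F G \<Delta>x v \<alpha> i" for \<alpha> i
    by (simp add: num_flux_def v'_def)
  have v'0: "v' \<alpha> 0 = v' \<beta> 0" for \<alpha> \<beta>
    using vertex by (simp add: v'_def)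
  have diff: "(w \<alpha> i - v' \<alpha> i) / \<Delta>t = c - num_flux F G \<Delta>x v \<alpha> i" for \<alpha> i
    using pos by (simp add: w v'_def field_simps)
  show "num_flux F G \<Delta>x w \<alpha> i \<le> c" if "\<And>\<alpha> i. num_flux F G \<Delta>x v \<alpha> i \<le> c"
  proof -
    have "v' \<alpha> i \<le> w \<alpha> i" for \<alpha> i
      using that pos by (simp add: w v'_def)
    from num_flux_monotone[where F = F and G = G and v = v' and w = w, OF pos F G v'0 vertex(2) this]
    have "num_flux F G \<Delta>x w \<alpha> i \<le> num_flux F G \<Delta>x v' \<alpha> i + (w \<alpha> i - v' \<alpha> i) / \<Delta>t" .
    then show ?thesis
      unfolding shift diff by simp
  qed
  show "c \<le> num_flux F G \<Delta>x w \<alpha> i" if "\<And>\<alpha> i. c \<le> num_flux F G \<Delta>x v \<alpha> i"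
  proof -
    have "w \<alpha> i \<le> v' \<alpha> i" for \<alpha> i
      using that pos by (simp add: w v'_def)
    from num_flux_monotone[where F = F and G = G and v = w and w = v', OF pos F G vertex(2) v'0 this]
    have "num_flux F G \<Delta>x v' \<alpha> i \<le> num_flux F G \<Delta>x w \<alpha> i + (v' \<alpha> i - w \<alpha> i) / \<Delta>t" .
    moreover have "(v' \<alpha> i - w \<alpha> i) / \<Delta>t = num_flux F G \<Delta>x v \<alpha> i - c"
      using diff[of \<alpha> i] pos by (simp add: field_simps)
    ultimately show ?thesis
      unfolding shift by simp
  qed
qed

section \<open>Propagation of the time bounds under the CFL condition\<close>

text \<open>The CFL condition concerns the slope intervals at level \<open>- m0\<close>, so the
  invariant is run with the exact infimum \<open>\<mu>\<close> of the initial \<open>W\<close>; the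
  bound by \<open>m\<close> then follows from \<open>m \<le> \<mu>\<close>.\<close>

lemma scheme_time_bounds:
  assumes A1: "A1 H p0" and pos: "\<Delta>t > 0" "\<Delta>x > 0"
    and sch: "scheme H p0 \<Delta>t \<Delta>x U" and CFL: "CFL H p0 \<Delta>t \<Delta>x U"
    and lower: "\<And>\<alpha> i. m \<le> W \<Delta>t U \<alpha> 0 i" and upper: "\<And>\<alpha> i. W \<Delta>t U \<alpha> 0 i \<le> M"
  shows "m \<le> W \<Delta>t U \<alpha> n i" "W \<Delta>t U \<alpha> n i \<le> M"
proof -
  let ?Q = "\<Delta>x / \<Delta>t"
  have Q: "?Q > 0"
    using pos by simp
  have m0_lower: "ereal m \<le> m0 \<Delta>t U"
    using lower by (auto simp: m0_def intro!: INF_greatest)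
  have m0_le: "m0 \<Delta>t U \<le> ereal (W \<Delta>t U \<alpha> 0 i)" for \<alpha> i
    unfolding m0_def by (rule INF_lower2[of "(\<alpha>, i)"]) auto
  obtain \<mu> where \<mu>: "m0 \<Delta>t U = ereal \<mu>"
    using m0_lower m0_le by (cases "m0 \<Delta>t U") auto
  have m\<mu>: "m \<le> \<mu>" and W0: "\<mu> \<le> W \<Delta>t U \<alpha> 0 i" for \<alpha> i
    using m0_lower m0_le \<mu> by auto
  define g where "g \<alpha> n i = (U \<alpha> n (i + 1) - U \<alpha> n i) / \<Delta>x" for \<alpha> n i
  let ?flux = "\<lambda>n. num_flux (Hminus H p0) (Hplus H p0) \<Delta>x (\<lambda>\<alpha>. U \<alpha> n)"
  have flux0: "?flux 0 \<alpha> i \<le> - \<mu>" for \<alpha> i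
    using W0[of \<alpha> i] W_eq_num_flux[OF sch, of \<alpha> 0 i] by simp
  \<comment> \<open>An initial gradient has \<open>Hminus\<close> at most \<open>- \<mu>\<close>,
    while values of \<open>Hminus\<close> are values of \<open>H \<alpha>\<close>; hence the level
    \<open>- \<mu>\<close> is not below the minimum and both inverses are finite.\<close>
  have min\<mu>: "H \<alpha> (p0 \<alpha>) \<le> - \<mu>" for \<alpha>
    using num_flux_gradient_le(1)[of "Hminus H p0" "Hplus H p0" \<Delta>x "\<lambda>\<alpha>. U \<alpha> 0", OF flux0, of \<alpha> 0]
      A1_minimum[OF A1] by (auto simp: Hminus_eq_min intro: order_trans)
  have "\<exists>r. Hminus_inv H p0 \<alpha> (- m0 \<Delta>t U) = ereal r \<and> Hminus H p0 \<alpha> r = - \<mu> \<and>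
      (\<forall>p. Hminus H p0 \<alpha> p \<le> - \<mu> \<longrightarrow> r \<le> p)" for \<alpha>
    using Hminus_inv_real[OF A1 min\<mu>[of \<alpha>]] unfolding \<mu> uminus_ereal.simps by metis
  then obtain lo where lo: "\<And>\<alpha>. Hminus_inv H p0 \<alpha> (- m0 \<Delta>t U) = ereal (lo \<alpha>)"
    "\<And>\<alpha>. Hminus H p0 \<alpha> (lo \<alpha>) = - \<mu>" "\<And>\<alpha> p. Hminus H p0 \<alpha> p \<le> - \<mu> \<Longrightarrow> lo \<alpha> \<le> p"
    by metis
  have "\<exists>r. Hplus_inv H p0 \<alpha> (- m0 \<Delta>t U) = ereal r \<and> Hplus H p0 \<alpha> r = - \<mu> \<and>
      (\<forall>p. Hplus H p0 \<alpha> p \<le> - \<mu> \<longrightarrow> p \<le> r)" for \<alpha>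
    using Hplus_inv_real[OF A1 min\<mu>[of \<alpha>]] unfolding \<mu> uminus_ereal.simps by metis
  then obtain up where up: "\<And>\<alpha>. Hplus_inv H p0 \<alpha> (- m0 \<Delta>t U) = ereal (up \<alpha>)"
    "\<And>\<alpha>. Hplus H p0 \<alpha> (up \<alpha>) = - \<mu>" "\<And>\<alpha> p. Hplus H p0 \<alpha> p \<le> - \<mu> \<Longrightarrow> p \<le> up \<alpha>"
    by metis
  have p0_bounds: "lo \<alpha> \<le> p0 \<alpha>" "p0 \<alpha> \<le> up \<alpha>" for \<alpha>
    using lo(3) up(3) min\<mu> by (auto simp: Hminus_def Hplus_def)
  have deriv_le: "\<bar>deriv (H \<alpha>) p\<bar> \<le> ?Q" if "lo \<alpha> \<le> p" "p \<le> up \<alpha>" for \<alpha> p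
  proof -
    have "ereal \<bar>deriv (H \<alpha>) p\<bar> \<le> ereal ?Q"
      using that by (intro order_trans[OF _ CFL[unfolded CFL_def]] SUP_upper2[of "(\<alpha>, p)"]) (auto simp: lo up)
    then show ?thesis
      by simp
  qed
  have lip: "\<bar>H \<alpha> q - H \<alpha> p\<bar> \<le> ?Q * (q - p)" if "lo \<alpha> \<le> p" "p \<le> q" "q \<le> up \<alpha>" for \<alpha> p q
  proof (cases "p = q")
    case False
    with that have "p < q"
      by simp
    then obtain z where z: "p < z" "z < q" "H \<alpha> q - H \<alpha> p = (q - p) * deriv (H \<alpha>) z"
      using MVT2[of p q "H \<alpha>" "deriv (H \<alpha>)"] A1_DERIV[OF A1] by blast
    have "(q - p) * \<bar>deriv (H \<alpha>) z\<bar> \<le> (q - p) * ?Q"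
      using deriv_le[of \<alpha> z] z that by (intro mult_left_mono) auto
    then show ?thesis
      using z \<open>p < q\<close> by (simp add: abs_mult mult.commute)
  qed simp
  \<comment> \<open>Extending with slope \<open>\<Delta>x / \<Delta>t\<close> beyond \<open>[lo, up]\<close> makes the scheme monotone on all grid
    functions, and any grid function whose modified flux is \<open>\<le> - \<mu>\<close> has its gradients in
    \<open>[lo, up]\<close>, where nothing was modified. This avoids assuming a gradient bound at the next step.\<close>
  define F where "F \<alpha> p = Hminus H p0 \<alpha> (max p (lo \<alpha>)) + ?Q * max 0 (lo \<alpha> - p)" for \<alpha> p
  define G where "G \<alpha> p = Hplus H p0 \<alpha> (min p (up \<alpha>)) + ?Q * max 0 (p - up \<alpha>)" for \<alpha> p
  have F: "F \<alpha> q \<le> F \<alpha> p \<and> F \<alpha> p \<le> F \<alpha> q + ?Q * (q - p)" if "p \<le> q" for \<alpha> p q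
  proof -
    \<comment> \<open>\<open>F\<close> is \<open>H \<alpha>\<close> at the clamp of its argument to
      \<open>[lo, p0]\<close> plus the linear extension. The parts of \<open>[p, q]\<close> below
      \<open>lo\<close> and inside \<open>[lo, p0]\<close> have total length at most
      \<open>q - p\<close>, and the slope is at most \<open>\<Delta>x / \<Delta>t\<close> on
      each.\<close>
    define c where "c x = min (max x (lo \<alpha>)) (p0 \<alpha>)" for x
    have c: "lo \<alpha> \<le> c p" "c p \<le> c q" "c q \<le> p0 \<alpha>" "c q \<le> up \<alpha>"
      "c q - c p \<le> (q - p) - (max 0 (lo \<alpha> - p) - max 0 (lo \<alpha> - q))"
      using that p0_bounds[of \<alpha>] by (auto simp: c_def min_def max_def)
    have "?Q * (c q - c p) \<le> ?Q * ((q - p) - (max 0 (lo \<alpha> - p) - max 0 (lo \<alpha> - q)))"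
      using c(5) Q by (intro mult_left_mono) auto
    moreover have "?Q * max 0 (lo \<alpha> - q) \<le> ?Q * max 0 (lo \<alpha> - p)"
      using that Q by (intro mult_left_mono) auto
    ultimately show ?thesis
      using lip[of \<alpha> "c p" "c q"] A1_decreasing[OF A1, of "c p" "c q" \<alpha>] c
      unfolding F_def Hminus_eq_min c_def[symmetric] right_diff_distrib by linarith
  qed
  have G: "G \<alpha> p \<le> G \<alpha> q \<and> G \<alpha> q \<le> G \<alpha> p + ?Q * (q - p)" if "p \<le> q" for \<alpha> p q
  proof -
    \<comment> \<open>Same splitting for \<open>G\<close>, with the clamp to \<open>[p0, up]\<close>
      and the extension above \<open>up\<close>.\<close>
    define c where "c x = max (min x (up \<alpha>)) (p0 \<alpha>)" for x
    have c: "lo \<alpha> \<le> c p" "c p \<le> c q" "p0 \<alpha> \<le> c p" "c q \<le> up \<alpha>"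
      "c q - c p \<le> (q - p) - (max 0 (q - up \<alpha>) - max 0 (p - up \<alpha>))"
      using that p0_bounds[of \<alpha>] by (auto simp: c_def min_def max_def)
    have "?Q * (c q - c p) \<le> ?Q * ((q - p) - (max 0 (q - up \<alpha>) - max 0 (p - up \<alpha>)))"
      using c(5) Q by (intro mult_left_mono) auto
    moreover have "?Q * max 0 (p - up \<alpha>) \<le> ?Q * max 0 (q - up \<alpha>)"
      using that Q by (intro mult_left_mono) auto
    ultimately show ?thesis
      using lip[of \<alpha> "c p" "c q"] A1_increasing[OF A1, of \<alpha> "c p" "c q"] c
      unfolding G_def Hplus_eq_max c_def[symmetric] right_diff_distrib by linarith
  qed
  let ?flux' = "\<lambda>n. num_flux F G \<Delta>x (\<lambda>\<alpha>. U \<alpha> n)"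
  have vertex: "U \<alpha> n 0 = U \<beta> n 0" for \<alpha> \<beta> n
    using sch unfolding scheme_def by blast
  have Usuc: "U \<alpha> (Suc n) i = U \<alpha> n i - \<Delta>t * ?flux n \<alpha> i" for \<alpha> n i
    using W_eq_num_flux[OF sch, of \<alpha> n i] pos by (simp add: W_def field_simps)
  have same: "?flux' n \<alpha> i = ?flux n \<alpha> i"
    if "\<And>\<alpha> i. lo \<alpha> \<le> g \<alpha> n i \<and> g \<alpha> n i \<le> up \<alpha>" for n \<alpha> i
  proof -
    have "F \<beta> p = Hminus H p0 \<beta> p" "G \<beta> p = Hplus H p0 \<beta> p" if "lo \<beta> \<le> p" "p \<le> up \<beta>" for \<beta> p
      using that by (simp_all add: F_def G_def max_absorb1 min_absorb1)
    then show ?thesis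
      using that[unfolded g_def] by (intro num_flux_cong) blast+
  qed
  have range_of_flux': "lo \<alpha> \<le> g \<alpha> n i \<and> g \<alpha> n i \<le> up \<alpha>"
    if "\<And>\<alpha> i. ?flux' n \<alpha> i \<le> - \<mu>" for n \<alpha> i
  proof -
    have "F \<alpha> (g \<alpha> n i) \<le> - \<mu>" "G \<alpha> (g \<alpha> n i) \<le> - \<mu>"
      unfolding g_def using num_flux_gradient_le[of F G \<Delta>x "\<lambda>\<alpha>. U \<alpha> n", OF that] by auto
    \<comment> \<open>Outside the interval the clamped envelope is frozen at exactly
      \<open>- \<mu>\<close>, and the extension adds a strictly positive amount.\<close>
    moreover have "F \<alpha> p > - \<mu>" if "p < lo \<alpha>" for p
      using that pos lo(2)[of \<alpha>] by (simp add: F_def)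
    moreover have "G \<alpha> p > - \<mu>" if "up \<alpha> < p" for p
      using that pos up(2)[of \<alpha>] by (simp add: G_def)
    ultimately show ?thesis
      by (meson not_le)
  qed
  \<comment> \<open>At the initial time the bound is known for the unmodified flux only, so the
    range comes from the extremality of \<open>lo\<close> and \<open>up\<close> instead.\<close>
  have range0: "lo \<alpha> \<le> g \<alpha> 0 i \<and> g \<alpha> 0 i \<le> up \<alpha>" for \<alpha> i
    unfolding g_def using num_flux_gradient_le[of "Hminus H p0" "Hplus H p0" \<Delta>x "\<lambda>\<alpha>. U \<alpha> 0", OF flux0]
      lo(3) up(3) by blast
  have inv: "(\<forall>\<alpha> i. ?flux' n \<alpha> i \<le> - \<mu>) \<and> (\<forall>\<alpha> i. - M \<le> ?flux' n \<alpha> i)" for n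
  proof (induction n)
    case 0
    have "- M \<le> ?flux 0 \<alpha> i" for \<alpha> i
      using upper[of \<alpha> i] W_eq_num_flux[OF sch, of \<alpha> 0 i] by simp
    then show ?case
      using flux0 by (simp add: same range0)
  next
    case (Suc n)
    \<comment> \<open>The upper bound of the induction hypothesis puts all gradients at step
      \<open>n\<close> into \<open>[lo, up]\<close>, so the actual step is also a step of the
      modified, globally monotone scheme.\<close>
    have "?flux' n \<alpha> i = ?flux n \<alpha> i" for \<alpha> i
      using Suc.IH by (intro same range_of_flux') blast
    then have "U \<alpha> (Suc n) i = U \<alpha> n i - \<Delta>t * ?flux' n \<alpha> i" for \<alpha> i
      by (simp only: Usuc)
    note step = num_flux_step[where v = "\<lambda>\<alpha>. U \<alpha> n" and w = "\<lambda>\<alpha>. U \<alpha> (Suc n)", OF pos F G vertex vertex this]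
    show ?case
      using Suc.IH step(1)[of "- \<mu>"] step(2)[of "- M"] by simp
  qed
  have "?flux' n \<alpha> i = ?flux n \<alpha> i"
    using inv by (intro same range_of_flux') blast
  then have "W \<Delta>t U \<alpha> n i = - ?flux' n \<alpha> i"
    by (simp add: W_eq_num_flux[OF sch])
  then show "m \<le> W \<Delta>t U \<alpha> n i" "W \<Delta>t U \<alpha> n i \<le> M"
    using inv[of n] m\<mu> by (smt (verit))+
qed

section \<open>Best slope constants of the initial data and the first time step\<close>

text \<open>The constant is the supremum of the difference quotients with \<open>a > 0\<close>,
  finite by the Lipschitz bound. Its existence gives the \<open>LEAST\<close> in
  \<open>Lplus\<close> its meaning.\<close>

lemma least_slope:
  fixes f :: "real \<Rightarrow> real"
  assumes "C-lipschitz_on {0..} f"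
  obtains L where "\<And>x a. x \<ge> 0 \<Longrightarrow> a \<ge> 0 \<Longrightarrow> f (x + a) - f x \<le> a * L"
    "\<And>L'. \<forall>x\<ge>0. \<forall>a\<ge>0. f (x + a) - f x \<le> a * L' \<Longrightarrow> L \<le> L'"
proof -
  define S where "S = (\<lambda>(x, a). (f (x + a) - f x) / a) ` ({0..} \<times> {0<..})"
  have "f (x + a) - f x \<le> C * a" if "x \<ge> 0" "a > 0" for x a
    using lipschitz_onD[OF assms(1), of "x + a" x] that by (simp add: dist_real_def)
  then have bdd: "bdd_above S"
    by (intro bdd_aboveI[of _ C]) (auto simp: S_def divide_le_eq)
  have ne: "S \<noteq> {}"
    by (auto simp: S_def)
  show thesis
  proof (rule that[of "Sup S"])
    show "f (x + a) - f x \<le> a * Sup S" if "x \<ge> 0" "a \<ge> 0" for x a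
    proof (cases "a = 0")
      case False
      then have "(f (x + a) - f x) / a \<le> Sup S"
        using that by (intro cSup_upper bdd) (force simp: S_def)
      then show ?thesis
        using that False by (simp add: divide_le_eq mult.commute)
    qed simp
    show "Sup S \<le> L" if "\<forall>x\<ge>0. \<forall>a\<ge>0. f (x + a) - f x \<le> a * L" for L
      using ne that by (intro cSup_least) (auto simp: S_def divide_le_eq mult.commute)
  qed
qed

lemma Lplus_bound:
  assumes "C-lipschitz_on {0..} (u0 \<alpha>)" "x \<ge> 0" "a \<ge> 0"
  shows "u0 \<alpha> (x + a) - u0 \<alpha> x \<le> a * Lplus u0 \<alpha>"
proof -
  obtain L where L: "\<And>x a. x \<ge> 0 \<Longrightarrow> a \<ge> 0 \<Longrightarrow> u0 \<alpha> (x + a) - u0 \<alpha> x \<le> a * L"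
    "\<And>L'. \<forall>x\<ge>0. \<forall>a\<ge>0. u0 \<alpha> (x + a) - u0 \<alpha> x \<le> a * L' \<Longrightarrow> L \<le> L'"
    using least_slope[OF assms(1)] by blast
  have "Lplus u0 \<alpha> = L"
    unfolding Lplus_def using L by (intro Least_equality) auto
  then show ?thesis
    using L(1) assms(2,3) by simp
qed

text \<open>The greatest lower slope of \<open>u0 \<alpha>\<close> is minus the least upper slope of
  its negative.\<close>

lemma Lminus_bound:
  assumes "C-lipschitz_on {0..} (u0 \<alpha>)" "x \<ge> 0" "a \<ge> 0"
  shows "a * Lminus u0 \<alpha> \<le> u0 \<alpha> (x + a) - u0 \<alpha> x"
proof -
  have "C-lipschitz_on {0..} (\<lambda>x. - u0 \<alpha> x)"
    using assms(1) by (simp add: lipschitz_on_def)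
  then obtain L where L: "\<And>x a. x \<ge> 0 \<Longrightarrow> a \<ge> 0 \<Longrightarrow> - u0 \<alpha> (x + a) - - u0 \<alpha> x \<le> a * L"
    "\<And>L'. \<forall>x\<ge>0. \<forall>a\<ge>0. - u0 \<alpha> (x + a) - - u0 \<alpha> x \<le> a * L' \<Longrightarrow> L \<le> L'"
    using least_slope by blast
  have "Lminus u0 \<alpha> = - L"
    unfolding Lminus_def
  proof (rule Greatest_equality)
    show "\<forall>x\<ge>0. \<forall>a\<ge>0. a * - L \<le> u0 \<alpha> (x + a) - u0 \<alpha> x"
    proof (intro allI impI)
      fix x a :: real
      assume "x \<ge> 0" "a \<ge> 0"
      then show "a * - L \<le> u0 \<alpha> (x + a) - u0 \<alpha> x"
        using L(1)[of x a] by simp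
    qed
    show "y \<le> - L" if "\<forall>x\<ge>0. \<forall>a\<ge>0. a * y \<le> u0 \<alpha> (x + a) - u0 \<alpha> x" for y
      using L(2)[of "- y"] that by force
  qed
  then show ?thesis
    using L(1)[OF assms(2,3)] by simp
qed

text \<open>A real infimum is a lower bound only if the family is bounded below: continuity bounds
  each \<open>H \<alpha>\<close> on its slope interval, and finitely many branches have a common
  bound.\<close>

lemma m00_le:
  assumes "A1 H p0" "Lminus u0 \<alpha> \<le> p" "p \<le> Lplus u0 \<alpha>"
  shows "H \<alpha> p \<le> - m00 H u0"
proof -
  let ?A = "{(\<alpha>, p). Lminus u0 \<alpha> \<le> p \<and> p \<le> Lplus u0 \<alpha>}"
  have "\<exists>B. \<forall>p. Lminus u0 \<alpha> \<le> p \<and> p \<le> Lplus u0 \<alpha> \<longrightarrow> H \<alpha> p \<le> B" for \<alpha>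
    using isCont_bounded[of "Lminus u0 \<alpha>" "Lplus u0 \<alpha>" "H \<alpha>"] DERIV_isCont[OF A1_DERIV[OF assms(1)]]
    by (cases "Lminus u0 \<alpha> \<le> Lplus u0 \<alpha>") auto
  then obtain B where B: "\<And>\<alpha> p. Lminus u0 \<alpha> \<le> p \<Longrightarrow> p \<le> Lplus u0 \<alpha> \<Longrightarrow> H \<alpha> p \<le> B \<alpha>"
    by metis
  have "H \<alpha> p \<le> Max (range B)" if "Lminus u0 \<alpha> \<le> p" "p \<le> Lplus u0 \<alpha>" for \<alpha> p
    using B[OF that] by (rule order_trans) simp
  then have "bdd_below ((\<lambda>(\<alpha>, p). - H \<alpha> p) ` ?A)"
    by (intro bdd_belowI[of _ "- Max (range B)"]) (auto simp del: minus_Max_eq_Min)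
  then have "m00 H u0 \<le> (\<lambda>(\<alpha>, p). - H \<alpha> p) (\<alpha>, p)"
    unfolding m00_def using assms(2,3) by (intro cINF_lower) auto
  then show ?thesis
    by simp
qed

text \<open>Initial gradients are difference quotients of \<open>u0\<close>, so they lie in
  \<open>[Lminus, Lplus]\<close> whatever the steps. The lower bound uses that both envelopes are at
  most \<open>H\<close>, the upper one their monotonicity up to the ends of that interval; the two
  entries of \<open>M00\<close> serve the nodes \<open>i \<ge> 1\<close> and the vertex.\<close>

lemma initial_time_bounds:
  assumes A0: "A0 u0" and A1: "A1 H p0" and pos: "\<Delta>t > 0" "\<Delta>x > 0"
    and num: "numerical_solution H p0 u0 \<Delta>t \<Delta>x U"
  shows "m00 H u0 \<le> W \<Delta>t U \<alpha> 0 i" "W \<Delta>t U \<alpha> 0 i \<le> M00 H p0 u0"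
proof -
  have sch: "scheme H p0 \<Delta>t \<Delta>x U" and init: "U \<alpha> 0 i = u0 \<alpha> (real i * \<Delta>x)" for \<alpha> i
    using num by (auto simp: numerical_solution_def)
  define g where "g \<alpha> i = (U \<alpha> 0 (i + 1) - U \<alpha> 0 i) / \<Delta>x" for \<alpha> i
  have g: "Lminus u0 \<alpha> \<le> g \<alpha> i \<and> g \<alpha> i \<le> Lplus u0 \<alpha>" for \<alpha> i
  proof -
    obtain C where C: "C-lipschitz_on {0..} (u0 \<alpha>)"
      using A0 unfolding A0_def by blast
    have "real (i + 1) * \<Delta>x = real i * \<Delta>x + \<Delta>x"
      by (simp add: distrib_right)
    then show ?thesis
      using C pos Lplus_bound[of C u0 \<alpha> "real i * \<Delta>x" \<Delta>x] Lminus_bound[of C u0 \<alpha> "real i * \<Delta>x" \<Delta>x]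
      by (simp add: g_def init divide_le_eq le_divide_eq mult.commute)
  qed
  have W0: "W \<Delta>t U \<alpha> 0 0 = - (MAX \<beta>. Hminus H p0 \<beta> (g \<beta> 0))" for \<alpha>
    by (simp add: W_eq_num_flux[OF sch] num_flux_def g_def)
  have Wi: "W \<Delta>t U \<alpha> 0 (Suc j) = - max (Hplus H p0 \<alpha> (g \<alpha> j)) (Hminus H p0 \<alpha> (g \<alpha> (Suc j)))" for \<alpha> j
    by (simp add: W_eq_num_flux[OF sch] num_flux_def g_def)
  have upper: "Hminus H p0 \<alpha> (g \<alpha> i) \<le> - m00 H u0" "Hplus H p0 \<alpha> (g \<alpha> i) \<le> - m00 H u0" for \<alpha> i
    using m00_le[OF A1, of u0 \<alpha> "g \<alpha> i"] g[of \<alpha> i] Hminus_le[OF A1, of \<alpha> "g \<alpha> i"] Hplus_le[OF A1, of \<alpha> "g \<alpha> i"]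
    by auto
  have lower: "Hminus H p0 \<alpha> (Lplus u0 \<alpha>) \<le> Hminus H p0 \<alpha> (g \<alpha> i)"
    "Hplus H p0 \<alpha> (Lminus u0 \<alpha>) \<le> Hplus H p0 \<alpha> (g \<alpha> i)" for \<alpha> i
    using g[of \<alpha> i] Hminus_antimono[OF A1] Hplus_mono[OF A1] by auto
  show "m00 H u0 \<le> W \<Delta>t U \<alpha> 0 i"
  proof (cases i)
    case 0
    have "(MAX \<beta>. Hminus H p0 \<beta> (g \<beta> 0)) \<le> - m00 H u0"
      using upper(1) by (intro Max.boundedI) auto
    then show ?thesis
      unfolding 0 W0 by linarith
  next
    case (Suc j)
    then show ?thesis
      using upper(1)[of \<alpha> "Suc j"] upper(2)[of \<alpha> j] by (simp add: Wi)
  qed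
  show "W \<Delta>t U \<alpha> 0 i \<le> M00 H p0 u0"
  proof (cases i)
    case 0
    have "(MAX \<beta>. Hminus H p0 \<beta> (Lplus u0 \<beta>)) \<le> (MAX \<beta>. Hminus H p0 \<beta> (g \<beta> 0))"
      using lower(1) by (auto intro!: Max.boundedI order_trans[OF lower(1)] Max_ge)
    then show ?thesis
      unfolding 0 W0 M00_def le_max_iff_disj neg_le_iff_le by blast
  next
    case (Suc j)
    have "W \<Delta>t U \<alpha> 0 i \<le> - max (Hminus H p0 \<alpha> (Lplus u0 \<alpha>)) (Hplus H p0 \<alpha> (Lminus u0 \<alpha>))"
      using lower(1)[of \<alpha> "Suc j"] lower(2)[of \<alpha> j] by (simp add: Suc Wi max.coboundedI1 max.coboundedI2)
    also have "\<dots> \<le> (MAX \<alpha>. - max (Hminus H p0 \<alpha> (Lplus u0 \<alpha>)) (Hplus H p0 \<alpha> (Lminus u0 \<alpha>)))"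
      by (intro Max_ge) auto
    finally show ?thesis
      by (simp add: M00_def)
  qed
qed

section \<open>From grid increments to the limit\<close>

lemma sum_increment_bounds:
  fixes f :: "nat \<Rightarrow> real"
  assumes "\<And>i. c \<le> f (Suc i) - f i" "\<And>i. f (Suc i) - f i \<le> d" "i \<le> j"
  shows "real (j - i) * c \<le> f j - f i" "f j - f i \<le> real (j - i) * d"
proof -
  have "f j - f i = (\<Sum>k=i..<j. f (Suc k) - f k)"
    using assms(3) by (simp add: sum_Suc_diff')
  moreover have "real (j - i) * c \<le> (\<Sum>k=i..<j. f (Suc k) - f k)"
    using sum_bounded_below[of "{i..<j}" c "\<lambda>k. f (Suc k) - f k"] assms(1) by simp
  moreover have "(\<Sum>k=i..<j. f (Suc k) - f k) \<le> real (j - i) * d"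
    using sum_bounded_above[of "{i..<j}" "\<lambda>k. f (Suc k) - f k" d] assms(2) by simp
  ultimately show "real (j - i) * c \<le> f j - f i" "f j - f i \<le> real (j - i) * d"
    by simp_all
qed

lemma grid_point_bounds:
  fixes h x :: real
  assumes "h > 0" "x \<ge> 0"
  shows "real (nat \<lfloor>x / h\<rfloor>) * h \<le> x" "x - h \<le> real (nat \<lfloor>x / h\<rfloor>) * h"
proof -
  have eq: "real (nat \<lfloor>x / h\<rfloor>) = real_of_int \<lfloor>x / h\<rfloor>"
    using assms by simp
  have "real_of_int \<lfloor>x / h\<rfloor> * h \<le> x / h * h" "(x / h - 1) * h \<le> real_of_int \<lfloor>x / h\<rfloor> * h"
    using assms by (intro mult_right_mono; linarith)+
  then show "real (nat \<lfloor>x / h\<rfloor>) * h \<le> x" "x - h \<le> real (nat \<lfloor>x / h\<rfloor>) * h"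
    unfolding eq using assms by (simp_all add: left_diff_distrib)
qed

lemma grid_point_tendsto:
  fixes h :: "nat \<Rightarrow> real"
  assumes "\<And>k. h k > 0" "h \<longlonglongrightarrow> 0" "x \<ge> 0"
  shows "(\<lambda>k. real (nat \<lfloor>x / h k\<rfloor>) * h k) \<longlonglongrightarrow> x"
proof (rule tendsto_sandwich)
  show "(\<lambda>k. x - h k) \<longlonglongrightarrow> x"
    using tendsto_diff[OF tendsto_const assms(2), of x] by simp
  show "\<forall>\<^sub>F k in sequentially. x - h k \<le> real (nat \<lfloor>x / h k\<rfloor>) * h k"
    "\<forall>\<^sub>F k in sequentially. real (nat \<lfloor>x / h k\<rfloor>) * h k \<le> x"
    by (intro always_eventually allI grid_point_bounds assms)+
qed auto

text \<open>Uniform convergence on a compact set compares \<open>U\<close> with \<open>u\<close> at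
  the grid points, and continuity of \<open>u\<close> moves these points to
  \<open>(t, x)\<close>.\<close>

lemma scheme_converges_at:
  assumes cont: "continuous_on (full_dom e T) u"
    and pos: "\<And>k. \<Delta>t k > 0" "\<And>k. \<Delta>x k > 0" and lim: "\<Delta>t \<longlonglongrightarrow> 0" "\<Delta>x \<longlonglongrightarrow> 0"
    and conv: "scheme_converges e T \<Delta>t \<Delta>x U u"
    and "0 \<le> t" "t < T" "0 \<le> x"
  shows "(\<lambda>k. U k \<alpha> (nat \<lfloor>t / \<Delta>t k\<rfloor>) (nat \<lfloor>x / \<Delta>x k\<rfloor>)) \<longlonglongrightarrow> branch e u \<alpha> t x"
proof -
  define n where "n k = nat \<lfloor>t / \<Delta>t k\<rfloor>" for k
  define i where "i k = nat \<lfloor>x / \<Delta>x k\<rfloor>" for k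
  define P where "P k = (real (n k) * \<Delta>t k, (real (i k) * \<Delta>x k) *\<^sub>R e \<alpha>)" for k
  \<comment> \<open>Rounding down never passes \<open>t\<close> or \<open>x\<close>, so this one
    compact set contains all the grid points used and stays in the domain because
    \<open>t < T\<close>.\<close>
  define K where "K = {0..t} \<times> (\<lambda>y. y *\<^sub>R e \<alpha>) ` {0..x}"
  have "compact K"
    unfolding K_def by (intro compact_Times compact_continuous_image continuous_intros) auto
  have K_sub: "K \<subseteq> full_dom e T"
    using \<open>t < T\<close> by (auto simp: K_def full_dom_def junction_def half_line_def intro!: exI[of _ \<alpha>])
  have P_in: "P k \<in> K" for k
    using grid_point_bounds[OF pos(1) \<open>0 \<le> t\<close>, of k] grid_point_bounds[OF pos(2) \<open>0 \<le> x\<close>, of k] pos[of k]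
    by (auto simp: P_def K_def n_def i_def intro!: imageI)
  have "P \<longlonglongrightarrow> (t, x *\<^sub>R e \<alpha>)"
    unfolding P_def n_def i_def using assms by (intro tendsto_intros grid_point_tendsto) auto
  moreover have "(t, x *\<^sub>R e \<alpha>) \<in> K"
    using assms by (auto simp: K_def)
  ultimately have "(\<lambda>k. u (P k)) \<longlonglongrightarrow> u (t, x *\<^sub>R e \<alpha>)"
    using P_in K_sub by (intro continuous_on_tendsto_compose[OF cont] always_eventually allI) auto
  moreover have "(\<lambda>k. u (P k) - U k \<alpha> (n k) (i k)) \<longlonglongrightarrow> 0"
  proof -
    let ?s = "\<lambda>k. SUP (\<alpha>, n, i)\<in>{(\<alpha>, n, i). (real n * \<Delta>t k, (real i * \<Delta>x k) *\<^sub>R e \<alpha>) \<in> K}.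
        ennreal \<bar>branch e u \<alpha> (real n * \<Delta>t k) (real i * \<Delta>x k) - U k \<alpha> n i\<bar>"
    have s: "?s \<longlonglongrightarrow> ennreal 0"
      using conv \<open>compact K\<close> K_sub unfolding scheme_converges_def ennreal_0 by blast
    have "ennreal \<bar>u (P k) - U k \<alpha> (n k) (i k)\<bar> \<le> ?s k" for k
      using P_in[of k] by (intro SUP_upper2[of "(\<alpha>, n k, i k)"]) (auto simp: P_def branch_def)
    then have "(\<lambda>k. ennreal \<bar>u (P k) - U k \<alpha> (n k) (i k)\<bar>) \<longlonglongrightarrow> ennreal 0"
      by (intro tendsto_sandwich[OF _ _ tendsto_const s]) auto
    then have "(\<lambda>k. \<bar>u (P k) - U k \<alpha> (n k) (i k)\<bar>) \<longlonglongrightarrow> 0"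
      by (subst (asm) tendsto_ennreal_iff) auto
    then show ?thesis
      by (simp add: tendsto_rabs_zero_iff)
  qed
  ultimately have "(\<lambda>k. u (P k) - (u (P k) - U k \<alpha> (n k) (i k))) \<longlonglongrightarrow> u (t, x *\<^sub>R e \<alpha>) - 0"
    by (rule tendsto_diff)
  then show ?thesis
    by (simp add: n_def i_def branch_def)
qed

section \<open>The estimates for the limit function\<close>

theorem corollary1p6:
  fixes e :: "'n::finite \<Rightarrow> real^2"
    and u0 :: "'n \<Rightarrow> real \<Rightarrow> real"
    and H :: "'n \<Rightarrow> real \<Rightarrow> real"
    and p0 :: "'n \<Rightarrow> real"
    and T :: real
    and u :: "real \<times> (real^2) \<Rightarrow> real"
    and \<Delta>t \<Delta>x :: "nat \<Rightarrow> real"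
    and U :: "nat \<Rightarrow> 'n grid_fun"
  assumes "junction_dirs e"
    and "A0 u0"
    and "A1 H p0"
    and "T > 0"
    and "continuous_on (full_dom e T) u"
    and "viscosity_solution e T H p0 u0 u"
    and "\<And>k. \<Delta>t k > 0" and "\<And>k. \<Delta>x k > 0"
    and "\<Delta>t \<longlonglongrightarrow> 0" and "\<Delta>x \<longlonglongrightarrow> 0"
    and "\<And>k. numerical_solution H p0 u0 (\<Delta>t k) (\<Delta>x k) (U k)"
    and "\<And>k. CFL H p0 (\<Delta>t k) (\<Delta>x k) (U k)"
    and "scheme_converges e T \<Delta>t \<Delta>x U u"
  shows "\<forall>\<alpha>. \<forall>a\<ge>0. \<forall>x\<ge>0. \<forall>t\<in>{0..<T}.
      (t + a < T \<longrightarrow>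
         a * m00 H u0 \<le> branch e u \<alpha> (t + a) x - branch e u \<alpha> t x \<and>
         branch e u \<alpha> (t + a) x - branch e u \<alpha> t x \<le> a * M00 H p0 u0) \<and>
      ereal a * p_low H p0 u0 \<alpha> \<le> ereal (branch e u \<alpha> t (x + a) - branch e u \<alpha> t x) \<and>
      ereal (branch e u \<alpha> t (x + a) - branch e u \<alpha> t x) \<le> ereal a * p_up H p0 u0 \<alpha>"
proof (intro allI ballI impI)
  fix \<alpha> :: 'n and a x t :: real
  assume a: "a \<ge> 0" and x: "x \<ge> 0" and "t \<in> {0..<T}"
  then have t: "0 \<le> t" "t < T"
    by auto
  note pos = assms(7,8)
  have sch: "scheme H p0 (\<Delta>t k) (\<Delta>x k) (U k)" for k
    using assms(11) by (auto simp: numerical_solution_def)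
  \<comment> \<open>The constants depend on neither \<open>k\<close> nor the time level, so they
    survive the limit.\<close>
  have Wb: "m00 H u0 \<le> W (\<Delta>t k) (U k) \<beta> n i" "W (\<Delta>t k) (U k) \<beta> n i \<le> M00 H p0 u0" for k \<beta> n i
    using scheme_time_bounds[OF assms(3) pos sch assms(12)
        initial_time_bounds[OF assms(2,3) pos assms(11)]] by auto
  define n where "n s k = nat \<lfloor>s / \<Delta>t k\<rfloor>" for s k
  define i where "i y k = nat \<lfloor>y / \<Delta>x k\<rfloor>" for y k
  have limU: "(\<lambda>k. U k \<alpha> (n s k) (i y k)) \<longlonglongrightarrow> branch e u \<alpha> s y" if "0 \<le> s" "s < T" "0 \<le> y" for s y
    unfolding n_def i_def
    by (rule scheme_converges_at[OF assms(5) pos assms(9,10,13) that])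
  \<comment> \<open>Rounding down preserves order, so the truncated differences of indices below are
    true differences.\<close>
  have n_mono: "n s k \<le> n s' k" if "s \<le> s'" for s s' k
    using that pos(1)[of k] by (auto simp: n_def intro!: nat_mono floor_mono divide_right_mono)
  have i_mono: "i y k \<le> i y' k" if "y \<le> y'" for y y' k
    using that pos(2)[of k] by (auto simp: i_def intro!: nat_mono floor_mono divide_right_mono)
  have lim_n: "(\<lambda>k. real (n s' k - n s k) * \<Delta>t k) \<longlonglongrightarrow> s' - s" if "0 \<le> s" "s \<le> s'" for s s'
  proof -
    have "(\<lambda>k. real (n s' k) * \<Delta>t k - real (n s k) * \<Delta>t k) \<longlonglongrightarrow> s' - s"
      unfolding n_def using that assms by (intro tendsto_diff grid_point_tendsto) auto
    then show ?thesis
      using n_mono[OF that(2)] by (simp add: of_nat_diff left_diff_distrib)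
  qed
  have lim_i: "(\<lambda>k. real (i y' k - i y k) * \<Delta>x k) \<longlonglongrightarrow> y' - y" if "0 \<le> y" "y \<le> y'" for y y'
  proof -
    have "(\<lambda>k. real (i y' k) * \<Delta>x k - real (i y k) * \<Delta>x k) \<longlonglongrightarrow> y' - y"
      unfolding i_def using that assms by (intro tendsto_diff grid_point_tendsto) auto
    then show ?thesis
      using i_mono[OF that(2)] by (simp add: of_nat_diff left_diff_distrib)
  qed
  have "a * m00 H u0 \<le> branch e u \<alpha> (t + a) x - branch e u \<alpha> t x \<and>
      branch e u \<alpha> (t + a) x - branch e u \<alpha> t x \<le> a * M00 H p0 u0" if ta: "t + a < T"
  proof -
    \<comment> \<open>\<open>?D\<close> telescopes over the time steps between the two rounded
      times, whose total duration \<open>?d\<close> tends to \<open>a\<close>.\<close>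
    let ?D = "\<lambda>k. U k \<alpha> (n (t + a) k) (i x k) - U k \<alpha> (n t k) (i x k)"
    let ?d = "\<lambda>k. real (n (t + a) k - n t k) * \<Delta>t k"
    have D: "?D \<longlonglongrightarrow> branch e u \<alpha> (t + a) x - branch e u \<alpha> t x"
      using t a x ta by (intro tendsto_diff limU) auto
    have d: "?d \<longlonglongrightarrow> a"
      using lim_n[of t "t + a"] t a by simp
    have incr: "\<Delta>t k * m00 H u0 \<le> U k \<alpha> (Suc j) l - U k \<alpha> j l"
      "U k \<alpha> (Suc j) l - U k \<alpha> j l \<le> \<Delta>t k * M00 H p0 u0" for k j l
      using Wb[of k \<alpha> j l] pos(1)[of k] by (simp_all add: W_def field_simps)
    have "?d k * m00 H u0 \<le> ?D k" "?D k \<le> ?d k * M00 H p0 u0" for k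
      using sum_increment_bounds[of _ "\<lambda>j. U k \<alpha> j (i x k)", OF incr n_mono[of t "t + a" k]] a
      by (simp_all add: mult.assoc)
    then show ?thesis
      using LIMSEQ_le[OF tendsto_mult_right[OF d, of "m00 H u0"] D]
        LIMSEQ_le[OF D tendsto_mult_right[OF d, of "M00 H p0 u0"]] by blast
  qed
  moreover
  \<comment> \<open>The lower bound on \<open>W\<close> at any time level is an upper bound on the
    flux there, hence confines all space gradients of that level between the two generalized
    inverses.\<close>
  have flux: "num_flux (Hminus H p0) (Hplus H p0) (\<Delta>x k) (\<lambda>\<beta>. U k \<beta> j) \<beta> l \<le> - m00 H u0" for k j \<beta> l
    using Wb(1)[of k \<beta> j l] by (simp add: W_eq_num_flux[OF sch])
  note grad = num_flux_gradient_le[OF flux]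
  have minH: "H \<alpha> (p0 \<alpha>) \<le> - m00 H u0"
    using order_trans[OF A1_minimum[OF assms(3)] grad(1)[unfolded Hminus_eq_min]] .
  obtain lo where lo: "p_low H p0 u0 \<alpha> = ereal lo" "\<And>p. Hminus H p0 \<alpha> p \<le> - m00 H u0 \<Longrightarrow> lo \<le> p"
    using Hminus_inv_real[OF assms(3) minH] unfolding p_low_def by metis
  obtain up where up: "p_up H p0 u0 \<alpha> = ereal up" "\<And>p. Hplus H p0 \<alpha> p \<le> - m00 H u0 \<Longrightarrow> p \<le> up"
    using Hplus_inv_real[OF assms(3) minH] unfolding p_up_def by metis
  have "a * lo \<le> branch e u \<alpha> t (x + a) - branch e u \<alpha> t x \<and>
      branch e u \<alpha> t (x + a) - branch e u \<alpha> t x \<le> a * up"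
  proof -
    let ?D = "\<lambda>k. U k \<alpha> (n t k) (i (x + a) k) - U k \<alpha> (n t k) (i x k)"
    let ?d = "\<lambda>k. real (i (x + a) k - i x k) * \<Delta>x k"
    have D: "?D \<longlonglongrightarrow> branch e u \<alpha> t (x + a) - branch e u \<alpha> t x"
      using t a x by (intro tendsto_diff limU) auto
    have d: "?d \<longlonglongrightarrow> a"
      using lim_i[of x "x + a"] x a by simp
    have incr: "\<Delta>x k * lo \<le> U k \<alpha> j (Suc l) - U k \<alpha> j l"
      "U k \<alpha> j (Suc l) - U k \<alpha> j l \<le> \<Delta>x k * up" for k j l
      using lo(2)[OF grad(1)[of \<alpha> k j l]] up(2)[OF grad(2)[of \<alpha> k j l]] pos(2)[of k]
      by (simp_all add: field_simps)
    have "?d k * lo \<le> ?D k" "?D k \<le> ?d k * up" for k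
      using sum_increment_bounds[of _ "\<lambda>l. U k \<alpha> (n t k) l", OF incr i_mono[of x "x + a" k]] a
      by (simp_all add: mult.assoc)
    then show ?thesis
      using LIMSEQ_le[OF tendsto_mult_right[OF d, of lo] D]
        LIMSEQ_le[OF D tendsto_mult_right[OF d, of up]] by blast
  qed
  ultimately show "(t + a < T \<longrightarrow>
         a * m00 H u0 \<le> branch e u \<alpha> (t + a) x - branch e u \<alpha> t x \<and>
         branch e u \<alpha> (t + a) x - branch e u \<alpha> t x \<le> a * M00 H p0 u0) \<and>
      ereal a * p_low H p0 u0 \<alpha> \<le> ereal (branch e u \<alpha> t (x + a) - branch e u \<alpha> t x) \<and>
      ereal (branch e u \<alpha> t (x + a) - branch e u \<alpha> t x) \<le> ereal a * p_up H p0 u0 \<alpha>"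
    by (simp add: lo up)
qed

end
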